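(* Let $G$ be a non-complete graph on $n$ vertices with minimum degree $\delta$, and let $n_u$ be the number of universal vertices of $G$ (vertices adjacent to all other vertices). Then $$\mathrm{box}(G)\ge \frac{n-n_u}{2(n-\delta-1)}.$$
   Context: An axis-parallel $b$-dimensional box is a Cartesian product $R_1\times\cdots\times R_b$ of closed real intervals. The boxicity $\mathrm{box}(G)$ of a graph $G$ is the minimum $b$ such that $G$ is the intersection graph of a family of axis-parallel $b$-dimensional boxes; equivalently, the minimum number $k$ of interval graphs $I_1,\dots,I_k$ on the vertex set $V(G)$ with $E(G)=E(I_1)\cap\cdots\cap E(I_k)$. Graphs are finite, simple and undirected. *)

theory Defs
  imports Complex_Main "HOL-Library.FuncSet" "Graph_Theory.Kuratowski"
begin

text \<open>
  A finite simple undirected graph is a symmetric digraph without loops and parallel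
  arcs (locale \<open>graph\<close>); each edge is a pair of opposite arcs, so the degree of a vertex is
  its out-degree.
\<close>

definition min_degree :: "('a, 'b) pre_digraph \<Rightarrow> nat" where
  "min_degree G = Min (out_degree G ` verts G)"

definition universal_verts :: "('a, 'b) pre_digraph \<Rightarrow> 'a set" where
  "universal_verts G = {v \<in> verts G. \<forall>u \<in> verts G - {v}. v \<rightarrow>\<^bsub>G\<^esub> u}"

text \<open>
  The dimension \<open>b\<close> varies, so points of \<open>b\<close>-dimensional space are extensional functions
  on \<open>{..<b}\<close>. Intervals are nonempty and bounded. For \<open>b = 0\<close> the only box is a one-point
  space, hence complete graphs get boxicity 0.
\<close>

definition axis_parallel_box :: "nat \<Rightarrow> (nat \<Rightarrow> real) set \<Rightarrow> bool" where
  "axis_parallel_box b B \<longleftrightarrow>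
     (\<exists>l u. (\<forall>i<b. l i \<le> u i) \<and> B = (\<Pi>\<^sub>E i\<in>{..<b}. {l i..u i}))"

definition is_intersection_graph :: "('a, 'b) pre_digraph \<Rightarrow> ('a \<Rightarrow> 'c set) \<Rightarrow> bool" where
  "is_intersection_graph G S \<longleftrightarrow>
     (\<forall>u\<in>verts G. \<forall>v\<in>verts G. u \<noteq> v \<longrightarrow> (u \<rightarrow>\<^bsub>G\<^esub> v \<longleftrightarrow> S u \<inter> S v \<noteq> {}))"

definition box_representable :: "nat \<Rightarrow> ('a, 'b) pre_digraph \<Rightarrow> bool" where
  "box_representable b G \<longleftrightarrow>
     (\<exists>S. (\<forall>v\<in>verts G. axis_parallel_box b (S v)) \<and> is_intersection_graph G S)"

definition boxicity :: "('a, 'b) pre_digraph \<Rightarrow> nat" where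
  "boxicity G = (LEAST b. box_representable b G)"

text \<open>
  The minimum is attained: use one coordinate per vertex \<open>w\<close>, with interval \<open>[0,0]\<close> for
  \<open>w\<close>, \<open>[0,1]\<close> for its neighbours and \<open>[1,1]\<close> for all other vertices.
\<close>

lemma box_representable_card_verts:
  assumes "graph G"
  shows "box_representable (card (verts G)) G"
proof -
  interpret graph G by fact
  let ?n = "card (verts G)"
  obtain f where f: "bij_betw f {..<?n} (verts G)"
    using ex_bij_betw_nat_finite[OF finite_verts] by (auto simp: atLeast0LessThan)
  have sym: "u \<rightarrow>\<^bsub>G\<^esub> v \<longleftrightarrow> v \<rightarrow>\<^bsub>G\<^esub> u" for u v
    by (rule iffI) (erule arcs_ends_symmetric[OF sym_arcs])+
  define l :: "'a \<Rightarrow> nat \<Rightarrow> real"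
    where "l v i = (if v = f i \<or> v \<rightarrow>\<^bsub>G\<^esub> f i then 0 else 1)" for v i
  define r :: "'a \<Rightarrow> nat \<Rightarrow> real" where "r v i = (if v = f i then 0 else 1)" for v i
  define S where "S v = (\<Pi>\<^sub>E i\<in>{..<?n}. {l v i..r v i})" for v
  have box: "axis_parallel_box ?n (S v)" for v
    unfolding axis_parallel_box_def
    by (rule exI[of _ "l v"], rule exI[of _ "r v"])
      (auto simp: S_def l_def r_def dest: adj_not_same)
  have "u \<rightarrow>\<^bsub>G\<^esub> v \<longleftrightarrow> S u \<inter> S v \<noteq> {}"
    if uv: "u \<in> verts G" "v \<in> verts G" "u \<noteq> v" for u v
  proof
    assume adj: "u \<rightarrow>\<^bsub>G\<^esub> v"
    let ?x = "\<lambda>i\<in>{..<?n}. max (l u i) (l v i)"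
    have "?x \<in> S u" "?x \<in> S v"
      using adj sym[THEN iffD1, OF adj] uv by (auto simp: S_def l_def r_def)
    then show "S u \<inter> S v \<noteq> {}" by blast
  next
    assume "S u \<inter> S v \<noteq> {}"
    then obtain x where x: "x \<in> S u" "x \<in> S v" by blast
    obtain i where i: "i < ?n" "f i = u"
      using uv(1) bij_betw_imp_surj_on[OF f] by (metis imageE lessThan_iff)
    have "x i \<in> {l u i..r u i}" "x i \<in> {l v i..r v i}"
      using PiE_mem[OF x(1)[unfolded S_def]] PiE_mem[OF x(2)[unfolded S_def]] i(1)
      by simp_all
    then have "l v i \<le> r u i" by auto
    then have "v \<rightarrow>\<^bsub>G\<^esub> u"
      using i uv by (auto simp: l_def r_def split: if_splits)
    then show "u \<rightarrow>\<^bsub>G\<^esub> v" by (rule sym[THEN iffD2])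
  qed
  then have "is_intersection_graph G S" unfolding is_intersection_graph_def by blast
  with box show ?thesis unfolding box_representable_def by blast
qed

lemma box_representable_boxicity: "graph G \<Longrightarrow> box_representable (boxicity G) G"
  unfolding boxicity_def by (rule LeastI) (rule box_representable_card_verts)

end

theory Submission
  imports Defs
begin

text \<open>
  In a representation by \<open>b\<close>-dimensional boxes pick, for every coordinate \<open>i\<close>, a vertex \<open>p i\<close> whose
  interval has the smallest right end and a vertex \<open>q i\<close> whose interval has the largest left end.
  If \<open>v\<close> is not universal, some coordinate \<open>i\<close> separates the box of \<open>v\<close> from another box, and then
  it also separates \<open>v\<close> from \<open>p i\<close> or from \<open>q i\<close>. Hence the \<open>2 * b\<close> vertices \<open>p i\<close>, \<open>q i\<close> have all
  non-universal vertices among their non-neighbours, and each vertex has at most \<open>n - \<delta> - 1\<close>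
  non-neighbours.
\<close>

definition non_neighbours :: "('a, 'b) pre_digraph \<Rightarrow> 'a \<Rightarrow> 'a set" where
  "non_neighbours G x = {v \<in> verts G. v \<noteq> x \<and> \<not> v \<rightarrow>\<^bsub>G\<^esub> x}"

text \<open>The vertex \<open>x\<close>, its non-neighbours and the heads of its outgoing arcs
  partition the vertices; without parallel arcs there are \<open>out_degree G x\<close> such heads.
  The additive form avoids truncated subtraction.\<close>

lemma (in graph) card_non_neighbours:
  assumes x: "x \<in> verts G"
  shows "card (non_neighbours G x) + out_degree G x + 1 = card (verts G)"
proof -
  let ?N = "head G ` out_arcs G x"
  have inj: "inj_on (head G) (out_arcs G x)"
    using no_multi_arcs by (auto simp: inj_on_def arc_to_ends_def)
  have N: "v \<in> ?N \<longleftrightarrow> v \<rightarrow>\<^bsub>G\<^esub> x" for v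
  proof -
    have "v \<in> ?N \<longleftrightarrow> x \<rightarrow>\<^bsub>G\<^esub> v"
      by (auto simp: arcs_ends_def arc_to_ends_def)
    then show ?thesis
      using arcs_ends_symmetric[OF sym_arcs] by blast
  qed
  have V: "verts G = insert x (non_neighbours G x \<union> ?N)"
    using x N by (auto simp: non_neighbours_def)
  have fin: "finite (non_neighbours G x)" "finite ?N"
    using finite_subset[OF _ finite_verts] by (auto simp: non_neighbours_def)
  have "x \<notin> non_neighbours G x \<union> ?N" "non_neighbours G x \<inter> ?N = {}"
    using N adj_not_same by (auto simp: non_neighbours_def)
  then have "card (verts G) = Suc (card (non_neighbours G x) + card ?N)"
    using fin by (subst V) (simp add: card_Un_disjoint)
  then show ?thesis
    by (simp add: out_degree_def card_image[OF inj])
qed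

lemma (in graph) min_degree_le:
  "x \<in> verts G \<Longrightarrow> min_degree G \<le> out_degree G x"
  unfolding min_degree_def by (simp add: finite_verts)

lemma (in graph) card_non_universal_le:
  assumes "box_representable b G"
  shows "card (verts G - universal_verts G) \<le> 2 * b * (card (verts G) - min_degree G - 1)"
\<comment> \<open>Without vertices the left side is 0; otherwise the extremal vertices
  \<open>p i\<close> and \<open>q i\<close> exist.\<close>
proof (cases "verts G = {}")
  case False
  let ?d = "card (verts G) - min_degree G - 1"
  from assms obtain S where box: "\<forall>v\<in>verts G. axis_parallel_box b (S v)"
    and S: "is_intersection_graph G S"
    unfolding box_representable_def by blast
  from box obtain l r :: "'a \<Rightarrow> nat \<Rightarrow> real"
    where le: "\<And>v i. v \<in> verts G \<Longrightarrow> i < b \<Longrightarrow> l v i \<le> r v i"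
      and box_eq: "\<And>v. v \<in> verts G \<Longrightarrow> S v = (\<Pi>\<^sub>E i\<in>{..<b}. {l v i..r v i})"
    unfolding axis_parallel_box_def by metis
  \<comment> \<open>Since each interval is nonempty, a strict gap rules out \<open>v = w\<close>;
    only then does the intersection property, which concerns distinct vertices, give
    non-adjacency.\<close>
  have sep: "v \<noteq> w \<and> \<not> v \<rightarrow>\<^bsub>G\<^esub> w"
    if "v \<in> verts G" "w \<in> verts G" "i < b" "r v i < l w i \<or> r w i < l v i" for v w i
  proof
    show "v \<noteq> w" using that le[of v i] by auto
    have "S v \<inter> S w = {}"
    proof (rule equals0I)
      fix x assume "x \<in> S v \<inter> S w"
      then have "x i \<in> {l v i..r v i}" "x i \<in> {l w i..r w i}"
        using that box_eq by (auto dest: PiE_mem)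
      with that(4) show False by auto
    qed
    then show "\<not> v \<rightarrow>\<^bsub>G\<^esub> w"
      using S that(1,2) \<open>v \<noteq> w\<close> unfolding is_intersection_graph_def by blast
  qed
  have ex_sep: "\<exists>i<b. r v i < l w i \<or> r w i < l v i"
    if vw: "v \<in> verts G" "w \<in> verts G" "v \<noteq> w" "\<not> v \<rightarrow>\<^bsub>G\<^esub> w" for v w
  proof (rule ccontr)
    assume "\<not> ?thesis"
    then have no: "l w i \<le> r v i" "l v i \<le> r w i" if "i < b" for i
      using that by (meson linorder_not_less)+
    \<comment> \<open>Two overlapping intervals share the larger of their left ends; doing this in
      every coordinate gives a common point of both boxes.\<close>
    let ?x = "\<lambda>i\<in>{..<b}. max (l v i) (l w i)"
    have "?x \<in> S v" "?x \<in> S w"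
      using no le vw by (auto simp: box_eq)
    then show False
      using S vw unfolding is_intersection_graph_def by blast
  qed
  have "\<exists>p\<in>verts G. \<forall>v\<in>verts G. r p i \<le> r v i" for i
  proof -
    have "Min ((\<lambda>v. r v i) ` verts G) \<in> (\<lambda>v. r v i) ` verts G"
      using False finite_verts by (intro Min_in) auto
    then obtain p where "p \<in> verts G" "Min ((\<lambda>v. r v i) ` verts G) = r p i"
      by blast
    then show ?thesis
      using Min_le[of "(\<lambda>v. r v i) ` verts G"] finite_verts
      by auto
  qed
  then obtain p where p: "\<And>i. p i \<in> verts G" "\<And>i v. v \<in> verts G \<Longrightarrow> r (p i) i \<le> r v i"
    by metis
  have "\<exists>q\<in>verts G. \<forall>v\<in>verts G. l v i \<le> l q i" for i
  proof -
    have "Max ((\<lambda>v. l v i) ` verts G) \<in> (\<lambda>v. l v i) ` verts G"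
      using False finite_verts by (intro Max_in) auto
    then obtain q where "q \<in> verts G" "Max ((\<lambda>v. l v i) ` verts G) = l q i"
      by blast
    then show ?thesis
      using Max_ge[of "(\<lambda>v. l v i) ` verts G"] finite_verts
      by auto
  qed
  then obtain q where q: "\<And>i. q i \<in> verts G" "\<And>i v. v \<in> verts G \<Longrightarrow> l v i \<le> l (q i) i"
    by metis
  let ?N = "\<lambda>i. non_neighbours G (p i) \<union> non_neighbours G (q i)"
  have "verts G - universal_verts G \<subseteq> (\<Union>i<b. ?N i)"
  proof
    fix v assume "v \<in> verts G - universal_verts G"
    then obtain w where v: "v \<in> verts G" and w: "w \<in> verts G" "v \<noteq> w" "\<not> v \<rightarrow>\<^bsub>G\<^esub> w"
      unfolding universal_verts_def by blast
    then obtain i where i: "i < b" "r v i < l w i \<or> r w i < l v i"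
      using ex_sep by blast
    \<comment> \<open>Replacing \<open>w\<close> by the extremal vertex on its side of
      \<open>v\<close> can only widen the gap.\<close>
    then have "r v i < l (q i) i \<or> r (p i) i < l v i"
      using p(2)[OF w(1), of i] q(2)[OF w(1), of i] by linarith
    then have "v \<in> ?N i"
      using sep[OF v q(1) i(1)] sep[OF v p(1) i(1)] v by (auto simp: non_neighbours_def)
    with i(1) show "v \<in> (\<Union>i<b. ?N i)" by blast
  qed
  moreover have "finite (non_neighbours G x)" for x
    by (simp add: non_neighbours_def finite_verts)
  ultimately have "card (verts G - universal_verts G) \<le> card (\<Union>i<b. ?N i)"
    by (intro card_mono) auto
  also have "\<dots> \<le> (\<Sum>i<b. card (?N i))"
    by (rule card_UN_le) simp
  also have "\<dots> \<le> (\<Sum>i<b. 2 * ?d)"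
  proof (rule sum_mono)
    fix i
    \<comment> \<open>The degree of \<open>x\<close> plus 1 is at most the number of vertices, so
      the subtractions in \<open>?d\<close> do not truncate.\<close>
    have "card (non_neighbours G x) \<le> ?d" if "x \<in> verts G" for x
      using card_non_neighbours[OF that] min_degree_le[OF that] by linarith
    from this[OF p(1)[of i]] this[OF q(1)[of i]] show "card (?N i) \<le> 2 * ?d"
      using card_Un_le[of "non_neighbours G (p i)" "non_neighbours G (q i)"]
      by linarith
  qed
  finally show ?thesis by (simp add: mult.commute mult.left_commute)
qed simp

text \<open>An endpoint of a missing edge has a non-neighbour, so its degree is at most the number
  of vertices minus 2. This makes the denominator of the final bound positive.\<close>

lemma (in graph) min_degree_less:
  assumes "\<not> complete_digraph (card (verts G)) G"
  shows "min_degree G + 1 < card (verts G)"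
proof -
  \<comment> \<open>\<open>G\<close> is a graph of the right order, so completeness can fail only in
    the arc set; as there are no loops, some pair of distinct vertices must be missing.\<close>
  have "arcs_ends G \<noteq> {(u, v). (u, v) \<in> verts G \<times> verts G \<and> u \<noteq> v}"
    using assms graph_axioms unfolding complete_digraph_def by simp
  moreover have "arcs_ends G \<subseteq> {(u, v). (u, v) \<in> verts G \<times> verts G \<and> u \<noteq> v}"
    using adj_not_same adj_in_verts by auto
  ultimately obtain u v where uv: "u \<in> verts G" "v \<in> verts G" "u \<noteq> v" "\<not> u \<rightarrow>\<^bsub>G\<^esub> v"
    by auto
  then have "u \<in> non_neighbours G v"
    by (simp add: non_neighbours_def)
  moreover have "finite (non_neighbours G v)"
    by (simp add: non_neighbours_def finite_verts)
  ultimately have "card (non_neighbours G v) > 0"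
    by (auto simp: card_gt_0_iff)
  then show ?thesis
    using card_non_neighbours[OF uv(2)] min_degree_le[OF uv(2)] by linarith
qed

theorem theorem9:
  fixes G :: "('a, 'b) pre_digraph" and n n_u \<delta> :: nat
  assumes "graph G"
    and "n = card (verts G)"
    and "\<not> complete_digraph n G"
    and "\<delta> = min_degree G"
    and "n_u = card (universal_verts G)"
  shows "real (boxicity G) \<ge> (real n - real n_u) / (2 * (real n - real \<delta> - 1))"
proof -
  interpret graph G by fact
  have d: "\<delta> + 1 < n"
    using min_degree_less assms by simp
  have U: "universal_verts G \<subseteq> verts G"
    by (auto simp: universal_verts_def)
  have "n - n_u \<le> 2 * boxicity G * (n - \<delta> - 1)"
    using card_non_universal_le[OF box_representable_boxicity[OF \<open>graph G\<close>]]
      card_Diff_subset[OF finite_subset[OF U finite_verts] U] assms by simp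
  \<comment> \<open>Together with \<open>\<delta> + 1 < n\<close>, this makes the natural-number
    subtractions agree with those over the reals.\<close>
  moreover have "n_u \<le> n"
    using card_mono[OF finite_verts U] assms by simp
  ultimately have "real n - real n_u \<le> real (2 * boxicity G * (n - \<delta> - 1))"
    by (simp only: of_nat_diff[symmetric] of_nat_le_iff)
  also have "\<dots> = real (boxicity G) * (2 * (real n - real \<delta> - 1))"
    using d by (simp add: of_nat_diff)
  finally show ?thesis
    using d by (simp add: divide_le_eq)
qed

end
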